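(* Let $(\mathfrak g,\{-,\cdots,-\})$ be an $n$-pre-Lie algebra. Then the induced $n$-bracket $$[x_1,\cdots,x_n]_C=\sum_{i=1}^n(-1)^{n-i}\{x_1,\cdots,\widehat{x_i},\cdots,x_n,x_i\}$$ defines an $n$-Lie algebra structure on $\mathfrak g$.
   Context: All vector spaces are finite dimensional over an algebraically closed field of characteristic $0$; $n\ge2$; a hat denotes omission. An $n$-Lie algebra is a vector space $\mathfrak g$ with a skew-symmetric linear map $[-,\cdots,-]_{\mathfrak g}:\wedge^n\mathfrak g\to\mathfrak g$ such that $[x_1,\cdots,x_{n-1},[y_1,\cdots,y_n]]=\sum_{i=1}^n[y_1,\cdots,y_{i-1},[x_1,\cdots,x_{n-1},y_i],y_{i+1},\cdots,y_n]$. An $n$-pre-Lie algebra is a vector space $\mathfrak g$ with a multilinear map $\{-,\cdots,-\}:\wedge^{n-1}\mathfrak g\otimes\mathfrak g\to\mathfrak g$ such that for all $x_i,y_j\in\mathfrak g$: (1) $\{x_1,\cdots,x_{n-1},\{y_1,\cdots,y_{n-1},y_n\}\}=\sum_{i=1}^{n-1}\{y_1,\cdots,y_{i-1},[x_1,\cdots,x_{n-1},y_i]_C,y_{i+1},\cdots,y_n\}+\{y_1,\cdots,y_{n-1},\{x_1,\cdots,x_{n-1},y_n\}\}$; (2) $\{[y_1,\cdots,y_n]_C,x_1,\cdots,x_{n-2},x_{n-1}\}=\sum_{i=1}^n(-1)^{n-i}\{y_1,\cdots,\widehat{y_i},\cdots,y_n,\{y_i,x_1,\cdots,x_{n-2},x_{n-1}\}\}$,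 where $[x_1,\cdots,x_n]_C=\sum_{i=1}^n(-1)^{n-i}\{x_1,\cdots,\widehat{x_i},\cdots,x_n,x_i\}$. *)

theory Defs
  imports "HOL-Computational_Algebra.Polynomial"
begin

text \<open>
  An \<open>n\<close>-ary operation on a vector space is a function on lists of vectors; only its values
  on lists of length \<open>n\<close> are ever constrained or used. List positions are counted from 0, so
  the sign \<open>(-1) ^ (n - i)\<close> of the \<open>i\<close>-th of \<open>n\<close> arguments becomes \<open>(-1) ^ (n - Suc i)\<close>.
\<close>

definition omit :: "nat \<Rightarrow> 'a list \<Rightarrow> 'a list" where
  "omit i xs = take i xs @ drop (Suc i) xs"

locale nary_operation = vector_space scale
  for scale :: "'k::{alg_closed_field, field_char_0} \<Rightarrow> 'v::ab_group_add \<Rightarrow> 'v" +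
  fixes n :: nat
    and br :: "'v list \<Rightarrow> 'v"
  assumes finite_dimensional: "\<exists>B. finite B \<and> span B = UNIV"
    and arity_ge_2: "n \<ge> 2"
    and multilinear: "\<lbrakk>length xs = n; i < n\<rbrakk> \<Longrightarrow>
          Vector_Spaces.linear scale scale (\<lambda>v. br (xs[i := v]))"

text \<open>
  Skew-symmetry in the first \<open>m\<close> of \<open>n\<close> arguments. As the ground field has characteristic 0,
  for a multilinear operation this says exactly that it factors through
  \<open>\<Lambda>\<^sup>m V \<otimes> V \<otimes> \<dots> \<otimes> V\<close>.
\<close>

definition skew_symmetric :: "nat \<Rightarrow> nat \<Rightarrow> ('v list \<Rightarrow> 'v::ab_group_add) \<Rightarrow> bool" where
  "skew_symmetric n m br \<longleftrightarrow>
     (\<forall>xs i j. length xs = n \<longrightarrow> i < j \<longrightarrow> j < m \<longrightarrow> br (xs[i := xs ! j, j := xs ! i]) = - br xs)"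

locale n_Lie_algebra = nary_operation scale n br
  for scale :: "'k::{alg_closed_field, field_char_0} \<Rightarrow> 'v::ab_group_add \<Rightarrow> 'v"
    and n :: nat
    and br :: "'v list \<Rightarrow> 'v" +
  assumes skew: "skew_symmetric n n br"
    and fundamental_identity: "\<lbrakk>length xs = n - 1; length ys = n\<rbrakk> \<Longrightarrow>
          br (xs @ [br ys]) = (\<Sum>i<n. br (ys[i := br (xs @ [ys ! i])]))"

definition induced_bracket ::
    "('k::field \<Rightarrow> 'v::ab_group_add \<Rightarrow> 'v) \<Rightarrow> nat \<Rightarrow> ('v list \<Rightarrow> 'v) \<Rightarrow> 'v list \<Rightarrow> 'v" where
  "induced_bracket scale n br xs =
     (\<Sum>i<n. scale ((-1) ^ (n - Suc i)) (br (omit i xs @ [xs ! i])))"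

locale n_pre_Lie_algebra = nary_operation scale n br
  for scale :: "'k::{alg_closed_field, field_char_0} \<Rightarrow> 'v::ab_group_add \<Rightarrow> 'v"
    and n :: nat
    and br :: "'v list \<Rightarrow> 'v" +
  assumes skew: "skew_symmetric n (n - 1) br"
    and pre_Lie_1: "\<lbrakk>length xs = n - 1; length ys = n - 1\<rbrakk> \<Longrightarrow>
          br (xs @ [br (ys @ [z])]) =
            (\<Sum>i<n - 1. br (ys[i := induced_bracket scale n br (xs @ [ys ! i])] @ [z]))
            + br (ys @ [br (xs @ [z])])"
    and pre_Lie_2: "\<lbrakk>length xs = n - 1; length ys = n\<rbrakk> \<Longrightarrow>
          br (induced_bracket scale n br ys # xs) =
            (\<Sum>i<n. scale ((-1) ^ (n - Suc i)) (br (omit i ys @ [br (ys ! i # xs)])))"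

end

theory Submission
  imports Defs
begin

text \<open>
  Write \<open>C\<close> for the induced bracket, \<open>xs\<close> for \<open>x\<^sub>1, \<dots>, x\<^bsub>n-1\<^esub>\<close> and \<open>ys\<close> for \<open>y\<^sub>1, \<dots>, y\<^sub>n\<close>.
  Multilinearity of \<open>C\<close> is inherited summand by summand. For skew-symmetry, exchange the
  arguments at positions \<open>i < j\<close>: a summand that singles out a third argument changes sign
  because \<open>br\<close> is skew in its first \<open>n - 1\<close> arguments, and the summands that single out
  positions \<open>i\<close> and \<open>j\<close> are exchanged, up to a cyclic rotation of \<open>j - i\<close> arguments whose sign
  \<open>(-1)\<^bsup>j-i-1\<^esup>\<close> combines with the two signs in the definition of \<open>C\<close> to \<open>-1\<close>.

  For the fundamental identity, split off the last summand of \<open>C\<close> on both sides: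
  \<open>C (xs, w) = br (xs, w) + R w\<close>, where \<open>R w\<close> collects the summands in which some \<open>x\<^sub>k\<close> is in the
  distinguished last place. With \<open>w = C ys\<close>, expanding \<open>br (xs, C ys)\<close> by the first pre-Lie
  identity gives every summand of \<open>\<Sum>\<^sub>j C (y\<^sub>1, \<dots>, C (xs, y\<^sub>j), \<dots>, y\<^sub>n)\<close> in which \<open>C (xs, y\<^sub>j)\<close> is
  not in the last place, and the part \<open>br (xs, y\<^sub>i)\<close> of those in which \<open>C (xs, y\<^sub>i)\<close> is in the
  last place. What is left is
  \<open>R (C ys) = \<Sum>\<^sub>i (-1)\<^bsup>n-i\<^esup> br (y\<^sub>1, \<dots>, omitting y\<^sub>i, \<dots>, y\<^sub>n, R y\<^sub>i)\<close>. This is a sum of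
  instances of the second pre-Lie identity, one for each \<open>x\<^sub>k\<close>, once \<open>w\<close> has been rotated to the
  front of \<open>br\<close> (lemma \<open>R_induced_bracket\<close>).
\<close>

section \<open>Omitting a list entry\<close>

lemma length_omit: "i < length xs \<Longrightarrow> length (omit i xs) = length xs - 1"
  by (simp add: omit_def)

lemma omit_append_Cons: "omit (length as) (as @ v # bs) = as @ bs"
  by (simp add: omit_def)

lemma omit_append_left: "i < length xs \<Longrightarrow> omit i (xs @ ys) = omit i xs @ ys"
  by (simp add: omit_def)

lemma nth_omit:
  "i < length xs \<Longrightarrow> j < length xs - 1 \<Longrightarrow> omit i xs ! j = xs ! (if j < i then j else Suc j)"
  by (auto simp: omit_def nth_append min_def)

lemma omit_update_same: "omit i (xs[i := v]) = omit i xs"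
  by (simp add: omit_def)

lemma omit_update_other:
  assumes "i < length xs" "j < length xs" "j \<noteq> i"
  shows "omit i (xs[j := v]) = (omit i xs)[(if j < i then j else j - 1) := v]"
  by (rule nth_equalityI) (use assms in \<open>auto simp: length_omit nth_omit nth_list_update\<close>)

section \<open>Multilinearity and skew-symmetry of the induced bracket\<close>

context nary_operation
begin

abbreviation ind :: "'v list \<Rightarrow> 'v" where
  "ind \<equiv> induced_bracket scale n br"

lemma linear_middle:
  assumes "length as + length bs = n - 1"
  shows "module_hom scale scale (\<lambda>v. br (as @ v # bs))"
proof -
  have "Vector_Spaces.linear scale scale (\<lambda>v. br ((as @ 0 # bs)[length as := v]))"
    by (rule multilinear) (use assms arity_ge_2 in auto)
  then show ?thesis
    by (simp add: linear_iff_module_hom)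
qed

lemma linear_last: "length as = n - 1 \<Longrightarrow> module_hom scale scale (\<lambda>v. br (as @ [v]))"
  using linear_middle[of as "[]"] by simp

lemma linear_induced_bracket:
  assumes "length xs = n" "j < n"
  shows "Vector_Spaces.linear scale scale (\<lambda>v. ind (xs[j := v]))"
proof -
  have "module_hom scale scale (\<lambda>v. br (omit i (xs[j := v]) @ [xs[j := v] ! i]))"
    if i: "i < n" for i
  proof (cases "i = j")
    case True
    then show ?thesis
      using assms linear_last[of "omit i xs"] by (simp add: omit_update_same length_omit)
  next
    case False
    define j' where "j' = (if j < i then j else j - 1)"
    have j': "j' < n - 1" using False i assms by (auto simp: j'_def)
    have "omit i (xs[j := v]) @ [xs[j := v] ! i] = (omit i xs @ [xs ! i])[j' := v]" for v
      using False i assms j'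
      by (simp add: omit_update_other length_omit list_update_append j'_def)
    then show ?thesis
      using multilinear[of "omit i xs @ [xs ! i]" j'] i assms j'
      by (simp add: length_omit linear_iff_module_hom)
  qed
  then have "module_hom scale scale (\<lambda>v. ind (xs[j := v]))"
    unfolding induced_bracket_def
    by (intro module_pair.module_hom_sum module_pair.module_hom_scale)
      (auto simp: module_pair_def module_axioms)
  then show ?thesis
    by (simp add: linear_iff_module_hom vector_space_axioms)
qed

text \<open>Moving an argument past \<open>length bs\<close> others is a product of \<open>length bs\<close> transpositions.\<close>

lemma skew_rotate:
  assumes "skew_symmetric n m br"
    and "length as + length bs < m" and "length as + length bs + length cs = n - 1"
  shows "br (as @ v # bs @ cs) = scale ((-1) ^ length bs) (br (as @ bs @ v # cs))"
  using assms(2,3)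
proof (induction bs arbitrary: as)
  case Nil
  then show ?case by simp
next
  case (Cons b bs)
  let ?ws = "as @ b # v # bs @ cs" and ?i = "length as"
  have "br (?ws[?i := ?ws ! Suc ?i, Suc ?i := ?ws ! ?i]) = - br ?ws"
    by (rule assms(1)[unfolded skew_symmetric_def, rule_format]) (use Cons.prems in auto)
  then have "br (as @ v # b # bs @ cs) = - br ((as @ [b]) @ v # bs @ cs)"
    by (simp add: nth_append list_update_append)
  also have "br ((as @ [b]) @ v # bs @ cs) =
      scale ((-1) ^ length bs) (br ((as @ [b]) @ bs @ v # cs))"
    using Cons.prems by (intro Cons.IH) auto
  finally show ?case by simp
qed

lemma skew_induced_bracket:
  assumes skew: "skew_symmetric n (n - 1) br"
  shows "skew_symmetric n n ind"
  unfolding skew_symmetric_def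
proof (intro allI impI)
  fix xs :: "'v list" and i j
  assume len: "length xs = n" and ij: "i < j" "j < n"
  define zs where "zs = xs[i := xs ! j, j := xs ! i]"
  define t where "t k ws = scale ((-1) ^ (n - Suc k)) (br (omit k ws @ [ws ! k]))" for k ws
  define as bs cs where "as = take i xs" and "bs = take (j - Suc i) (drop (Suc i) xs)"
    and "cs = drop (Suc j) xs"
  define u v where "u = xs ! i" and "v = xs ! j"
  have lens: "length as = i" "length bs = j - Suc i" "length cs = n - Suc j"
    using len ij by (auto simp: as_def bs_def cs_def)
  have xs: "xs = as @ u # bs @ v # cs"
  proof -
    have "xs = as @ u # drop (Suc i) xs"
      unfolding as_def u_def using len ij by (simp add: id_take_nth_drop)
    moreover have "drop (Suc i) xs = bs @ drop (j - Suc i) (drop (Suc i) xs)"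
      unfolding bs_def by (rule append_take_drop_id[symmetric])
    moreover have "drop (j - Suc i) (drop (Suc i) xs) = v # cs"
      unfolding cs_def v_def using len ij by (simp add: Cons_nth_drop_Suc)
    ultimately show ?thesis by metis
  qed
  have i: "i = length as" and j: "j = length (as @ u # bs)"
    using lens ij by auto
  have zs: "zs = as @ v # bs @ u # cs"
  proof -
    have "j - i = Suc (length bs)"
      using lens ij by simp
    then have "xs[i := v, j := u] = as @ v # bs @ u # cs"
      using lens ij by (subst xs) (simp add: list_update_append)
    then show ?thesis
      by (simp add: zs_def u_def v_def)
  qed
  \<comment> \<open>Both sides end in \<open>q\<close>; the remaining lists differ by moving \<open>p\<close> past \<open>bs\<close>.\<close>
  have swapped: "t i (as @ q # bs @ p # cs) = - t j (as @ p # bs @ q # cs)" for p q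
  proof -
    have omit_i: "omit i (as @ q # bs @ p # cs) = as @ bs @ p # cs"
      unfolding i by (rule omit_append_Cons)
    have omit_j: "omit j (as @ p # bs @ q # cs) = as @ p # bs @ cs"
      unfolding j using omit_append_Cons[of "as @ p # bs" q cs] by simp
    have nths: "(as @ q # bs @ p # cs) ! i = q" "(as @ p # bs @ q # cs) ! j = q"
      using lens ij by (simp_all add: nth_append)
    have rotate: "br (as @ p # bs @ cs @ [q]) =
        scale ((-1) ^ length bs) (br (as @ bs @ p # cs @ [q]))"
      using lens ij by (intro skew_rotate[OF skew]) auto
    have "n - Suc i = Suc (n - Suc j + length bs)"
      using lens ij by simp
    then show ?thesis
      by (simp add: t_def omit_i omit_j nths rotate power_add)
  qed
  have other: "t k zs = - t k xs" if k: "k < n" "k \<noteq> i" "k \<noteq> j" for k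
  proof -
    define i' j' where "i' = (if i < k then i else i - 1)" and "j' = (if j < k then j else j - 1)"
    have ij': "i' < j'" "j' < n - 1"
      using k ij by (auto simp: i'_def j'_def)
    have nths: "omit k xs ! i' = xs ! i" "omit k xs ! j' = xs ! j"
      using k ij ij' len by (auto simp: i'_def j'_def nth_omit)
    have "omit k zs @ [zs ! k] =
        (omit k xs @ [xs ! k])[i' := (omit k xs @ [xs ! k]) ! j', j' := (omit k xs @ [xs ! k]) ! i']"
      using k ij ij' len nths unfolding zs_def
      by (simp add: omit_update_other length_omit list_update_append nth_append
          flip: i'_def j'_def)
    then have "br (omit k zs @ [zs ! k]) = - br (omit k xs @ [xs ! k])"
      using skew k ij' len unfolding skew_symmetric_def by (simp add: length_omit)
    then show ?thesis by (simp add: t_def)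
  qed
  have split: "ind ws = t i ws + t j ws + (\<Sum>k\<in>{..<n} - {i, j}. t k ws)" for ws
  proof -
    have "ind ws = sum t' ({i, j} \<union> ({..<n} - {i, j}))" if "t' = (\<lambda>k. t k ws)" for t'
      unfolding induced_bracket_def t_def that using ij by (intro sum.cong) auto
    then show ?thesis
      using ij by (subst (asm) sum.union_disjoint) auto
  qed
  show "ind zs = - ind xs"
    using swapped[of v u] swapped[of u v] other
    by (simp add: split sum_negf flip: xs zs)
qed

end

section \<open>The fundamental identity\<close>

context n_pre_Lie_algebra
begin

text \<open>
  The summands of \<open>ind (xs @ [w])\<close> in which \<open>w\<close> is not in the distinguished last place. For
  \<open>n = 2\<close>, where \<open>br\<close> is a pre-Lie product, \<open>R [x]\<close> is the negative of right multiplication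
  by \<open>x\<close>.
\<close>

definition R :: "'v list \<Rightarrow> 'v \<Rightarrow> 'v" where
  "R xs w = (\<Sum>k<n - 1. scale ((-1) ^ (n - Suc k)) (br (omit k xs @ [w, xs ! k])))"

lemma induced_bracket_split_last:
  assumes "length xs = n - 1"
  shows "ind (xs @ [w]) = br (xs @ [w]) + R xs w"
proof -
  have n: "n = Suc (n - 1)" using arity_ge_2 by simp
  have "ind (xs @ [w]) = (\<Sum>k<Suc (n - 1).
      scale ((-1) ^ (n - Suc k)) (br (omit k (xs @ [w]) @ [(xs @ [w]) ! k])))"
    unfolding induced_bracket_def using n by simp
  also have "\<dots> = (\<Sum>k<n - 1.
      scale ((-1) ^ (n - Suc k)) (br (omit k (xs @ [w]) @ [(xs @ [w]) ! k]))) + br (xs @ [w])"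
    using assms omit_append_Cons[of xs w "[]"] by (subst sum.lessThan_Suc) (simp add: nth_append)
  also have "(\<Sum>k<n - 1.
      scale ((-1) ^ (n - Suc k)) (br (omit k (xs @ [w]) @ [(xs @ [w]) ! k]))) = R xs w"
    unfolding R_def
    by (intro sum.cong) (use assms in \<open>auto simp: omit_append_left nth_append\<close>)
  finally show ?thesis by simp
qed

text \<open>The sign is \<open>(-1)\<^bsup>n-2\<^esup>\<close>, from the \<open>n - 2\<close> entries of \<open>zs\<close> that \<open>w\<close> passes.\<close>

lemma rotate_to_front:
  assumes "length zs = n - 2"
  shows "br (zs @ [w, x]) = scale ((-1) ^ n) (br (w # zs @ [x]))"
proof -
  have "br (w # zs @ [x]) = scale ((-1) ^ (n - 2)) (br (zs @ [w, x]))"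
    using skew_rotate[OF skew, of "[]" zs "[x]" w] assms arity_ge_2 by simp
  moreover have "(-1) ^ n = ((-1) ^ (n - 2) :: 'k)"
    using arity_ge_2 by (simp add: uminus_power_if)
  ultimately show ?thesis by (simp flip: power_mult_distrib)
qed

text \<open>
  For fixed \<open>k\<close>, the \<open>k\<close>-th summands on the two sides agree by the second pre-Lie identity: that
  identity has the bracket at the front of \<open>br\<close>, here it stands next to the end, and the sign of
  moving it is the same for \<open>ind ys\<close> on the left and for each \<open>ys ! i\<close> on the right.
\<close>

lemma R_induced_bracket:
  assumes "length xs = n - 1" "length ys = n"
  shows "R xs (ind ys) =
    (\<Sum>i<n. scale ((-1) ^ (n - Suc i)) (br (omit i ys @ [R xs (ys ! i)])))"
proof -
  let ?s = "\<lambda>i. (-1) ^ (n - Suc i) :: 'k"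
  have lens: "length (omit k xs) = n - 2" if "k < n - 1" for k
    using assms that by (simp add: length_omit)
  have hom: "module_hom scale scale (\<lambda>v. br (omit i ys @ [v]))" if "i < n" for i
    using assms that by (intro linear_last) (simp add: length_omit)
  have summand: "br (omit k xs @ [ind ys, xs ! k]) =
      (\<Sum>i<n. scale (?s i) (br (omit i ys @ [br (omit k xs @ [ys ! i, xs ! k])])))"
    if k: "k < n - 1" for k
  proof -
    have "br (omit k xs @ [ind ys, xs ! k]) =
        scale ((-1) ^ n) (br (ind ys # omit k xs @ [xs ! k]))"
      using lens[OF k] by (rule rotate_to_front)
    also have "br (ind ys # omit k xs @ [xs ! k]) =
        (\<Sum>i<n. scale (?s i) (br (omit i ys @ [br (ys ! i # omit k xs @ [xs ! k])])))"
      using assms k lens[OF k] by (intro pre_Lie_2) auto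
    also have "scale ((-1) ^ n) \<dots> = (\<Sum>i<n. scale (?s i)
        (br (omit i ys @ [scale ((-1) ^ n) (br (ys ! i # omit k xs @ [xs ! k]))])))"
      unfolding scale_sum_right
      by (intro sum.cong) (auto simp: module_hom.scale[OF hom] mult.commute)
    finally show ?thesis
      by (simp add: rotate_to_front[OF lens[OF k]])
  qed
  have "R xs (ind ys) = (\<Sum>k<n - 1. \<Sum>i<n.
      scale (?s k) (scale (?s i) (br (omit i ys @ [br (omit k xs @ [ys ! i, xs ! k])]))))"
    unfolding R_def by (intro sum.cong refl) (simp add: summand scale_sum_right del: scale_scale)
  also have "\<dots> = (\<Sum>i<n. \<Sum>k<n - 1.
      scale (?s k) (scale (?s i) (br (omit i ys @ [br (omit k xs @ [ys ! i, xs ! k])]))))"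
    by (rule sum.swap)
  also have "\<dots> = (\<Sum>i<n. scale (?s i) (br (omit i ys @ [R xs (ys ! i)])))"
    unfolding R_def
    by (intro sum.cong refl)
      (simp add: module_hom.sum[OF hom] module_hom.scale[OF hom] scale_sum_right mult.commute)
  finally show ?thesis .
qed

lemma fundamental_identity_induced_bracket:
  assumes xs: "length xs = n - 1" and ys: "length ys = n"
  shows "ind (xs @ [ind ys]) = (\<Sum>j<n. ind (ys[j := ind (xs @ [ys ! j])]))"
proof -
  let ?s = "\<lambda>i. (-1) ^ (n - Suc i) :: 'k"
  let ?c = "\<lambda>j. ind (xs @ [ys ! j])"
  \<comment> \<open>The \<open>i\<close>-th summand, up to sign, of the \<open>j\<close>-th bracket on the right-hand side.\<close>
  let ?t = "\<lambda>i j. br (omit i (ys[j := ?c j]) @ [ys[j := ?c j] ! i])"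
  have hom: "module_hom scale scale (\<lambda>v. br (omit i ys @ [v]))" if "i < n" for i
    using ys that by (intro linear_last) (simp add: length_omit)
  have off_diagonal: "br (xs @ [br (omit i ys @ [ys ! i])]) =
      (\<Sum>j\<in>{..<n} - {i}. ?t i j) + br (omit i ys @ [br (xs @ [ys ! i])])"
    if i: "i < n" for i
  proof -
    have "br (xs @ [br (omit i ys @ [ys ! i])]) =
        (\<Sum>j<n - 1. br ((omit i ys)[j := ind (xs @ [omit i ys ! j])] @ [ys ! i]))
        + br (omit i ys @ [br (xs @ [ys ! i])])"
      using xs ys i by (intro pre_Lie_1) (auto simp: length_omit)
    also have "(\<Sum>j<n - 1. br ((omit i ys)[j := ind (xs @ [omit i ys ! j])] @ [ys ! i])) =
        (\<Sum>j\<in>{..<n} - {i}. ?t i j)"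
      \<comment> \<open>\<open>j\<close> on the left is a position in the shortened list, on the right one in \<open>ys\<close>.\<close>
      by (rule sum.reindex_bij_witness[of _ "\<lambda>j. if j < i then j else j - 1"
            "\<lambda>j. if j < i then j else Suc j"])
        (use i ys in \<open>auto simp: nth_omit omit_update_other split: if_splits\<close>)
    finally show ?thesis .
  qed
  have diagonal: "?t i i = br (omit i ys @ [br (xs @ [ys ! i])]) + br (omit i ys @ [R xs (ys ! i)])"
    if i: "i < n" for i
    using i xs ys
    by (simp add: omit_update_same induced_bracket_split_last module_hom.add[OF hom])
  have "br (xs @ [ind ys]) = (\<Sum>i<n. scale (?s i) (br (xs @ [br (omit i ys @ [ys ! i])])))"
    unfolding induced_bracket_def
    by (simp add: module_hom.sum[OF linear_last[OF xs]] module_hom.scale[OF linear_last[OF xs]])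
  then have "ind (xs @ [ind ys]) =
      (\<Sum>i<n. scale (?s i) (br (xs @ [br (omit i ys @ [ys ! i])])
        + br (omit i ys @ [R xs (ys ! i)])))"
    using xs ys
    by (simp add: induced_bracket_split_last R_induced_bracket sum.distrib scale_right_distrib)
  also have "\<dots> = (\<Sum>i<n. scale (?s i) (\<Sum>j<n. ?t i j))"
  proof (intro sum.cong refl arg_cong[where f = "scale _"])
    fix i assume "i \<in> {..<n}"
    then show "br (xs @ [br (omit i ys @ [ys ! i])]) + br (omit i ys @ [R xs (ys ! i)]) =
        (\<Sum>j<n. ?t i j)"
      using off_diagonal[of i] diagonal[of i] sum.remove[of "{..<n}" i "?t i"]
      by (simp add: algebra_simps)
  qed
  also have "\<dots> = (\<Sum>j<n. \<Sum>i<n. scale (?s i) (?t i j))"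
    unfolding scale_sum_right by (rule sum.swap)
  finally show ?thesis
    by (simp add: induced_bracket_def[of scale n br "ys[_ := _]"])
qed

end

theorem proposition3p14:
  fixes scale :: "'k::{alg_closed_field, field_char_0} \<Rightarrow> 'v::ab_group_add \<Rightarrow> 'v"
    and n :: nat
    and br :: "'v list \<Rightarrow> 'v"
  assumes "n_pre_Lie_algebra scale n br"
  shows "n_Lie_algebra scale n (induced_bracket scale n br)"
proof -
  interpret n_pre_Lie_algebra scale n br by fact
  show ?thesis
    by (intro n_Lie_algebra.intro nary_operation.intro nary_operation_axioms.intro
        n_Lie_algebra_axioms.intro vector_space_axioms finite_dimensional arity_ge_2
        linear_induced_bracket skew_induced_bracket skew fundamental_identity_induced_bracket)
qed

end
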